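(* None of the logics $\mathbf{bI}$, $\mathbf{nbI}$, $\mathbf{nbIciw}$, $\mathbf{nbIci}$, $\mathbf{nbIcl}$ is algebraizable in the sense of Blok and Pigozzi.
   Context: Let $\mathcal V$ be a countably infinite set of propositional variables, $\Sigma_{\mathbf{bI}}=\{\vee,\wedge,\rightarrow,\uparrow\}$ (all binary) and $\Sigma_{\mathbf{nbI}}=\Sigma_{\mathbf{bI}}\cup\{\neg\}$ with $\neg$ unary; $\mathbf F(\Sigma,\mathcal V)$ is the set of formulas over $\Sigma$. The logic $\mathbf{bI}$ (over $\Sigma_{\mathbf{bI}}$) is the Hilbert calculus whose only inference rule is Modus Ponens and whose axioms are all instances (with arbitrary formulas) of: (1) $\alpha\to(\beta\to\alpha)$; (2) $(\alpha\to(\beta\to\gamma))\to((\alpha\to\beta)\to(\alpha\to\gamma))$; (3) $\alpha\to(\beta\to(\alpha\wedge\beta))$; (4) $(\alpha\wedge\beta)\to\alpha$; (5) $(\alpha\wedge\beta)\to\beta$; (6) $\alpha\to(\alpha\vee\beta)$; (7) $\beta\to(\alpha\vee\beta)$; (8) $(\alpha\to\gamma)\to((\beta\to\gamma)\to((\alpha\vee\beta)\to\gamma))$; (9) $(\alpha\to\beta)\vee\alpha$; (Ip) $(\alpha\uparrow\beta)\to(\alpha\to(\beta\to\gamma))$; (Comm) $(\alpha\uparrow\beta)\to(\beta\uparrow\alpha)$. The logic $\mathbf{nbI}$ (over $\Sigma_{\mathbf{nbI}}$) has the same axiom schemata (instantiated over $\Sigma_{\mathbf{nbI}}$) plus $\alpha\vee\neg\alpha$,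 with Modus Ponens as only rule. The logics $\mathbf{nbIciw}$, $\mathbf{nbIci}$, $\mathbf{nbIcl}$ are obtained from $\mathbf{nbI}$ by adding, respectively, the schema $(\alpha\uparrow\neg\alpha)\vee(\alpha\wedge\neg\alpha)$; $\neg(\alpha\uparrow\neg\alpha)\to(\alpha\wedge\neg\alpha)$; $\neg(\alpha\wedge\neg\alpha)\to(\alpha\uparrow\neg\alpha)$. $\Gamma\vdash_{\mathcal L}\varphi$ denotes derivability of $\varphi$ from premises in $\Gamma$ in the calculus $\mathcal L$. Algebraizability (Blok–Pigozzi): a logic $\mathcal L$ over $\Sigma$ is algebraizable if there are a class (equivalently a quasivariety) $K$ of $\Sigma$-algebras whose equational consequence relation $\vDash_K$ is finitary, a finite set $E(x)$ of equations in one variable and a finite set $\Delta(x,y)$ of formulas in two variables such that (i) for all $\Gamma\cup\{\varphi\}$, $\Gamma\vdash_{\mathcal L}\varphi$ iff $\bigcup_{\gamma\in\Gamma}E(\gamma)\vDash_K E(\varphi)$, and (ii) $x\approx y$ and $\bigcup_{\delta\in\Delta}E(\delta(x,y))$ are mutual consequences under $\vDash_K$. *)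

theory Defs
  imports Main
begin

section \<open>Signatures, formulas and algebras\<close>

text \<open>A signature maps each of its operation symbols to its arity; symbols outside the domain
  do not belong to the signature.\<close>

type_synonym 'f signature = "'f \<Rightarrow> nat option"

datatype ('f, vars: 'v) fm = Var 'v | Op 'f "('f, 'v) fm list"

inductive_set formulas :: "'f signature \<Rightarrow> ('f, 'v) fm set" for \<Sigma> :: "'f signature" where
  Var: "Var x \<in> formulas \<Sigma>"
| Op: "\<lbrakk>\<Sigma> f = Some (length ts); \<And>t. t \<in> set ts \<Longrightarrow> t \<in> formulas \<Sigma>\<rbrakk> \<Longrightarrow> Op f ts \<in> formulas \<Sigma>"

primrec subst :: "('v \<Rightarrow> ('f, 'w) fm) \<Rightarrow> ('f, 'v) fm \<Rightarrow> ('f, 'w) fm" where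
  "subst \<sigma> (Var x) = \<sigma> x"
| "subst \<sigma> (Op f ts) = Op f (map (subst \<sigma>) ts)"

record ('f, 'a) algebra =
  univ :: "'a set"
  interp :: "'f \<Rightarrow> 'a list \<Rightarrow> 'a"

definition is_algebra :: "'f signature \<Rightarrow> ('f, 'a) algebra \<Rightarrow> bool" where
  "is_algebra \<Sigma> A \<longleftrightarrow> univ A \<noteq> {} \<and>
     (\<forall>f as. \<Sigma> f = Some (length as) \<longrightarrow> set as \<subseteq> univ A \<longrightarrow> interp A f as \<in> univ A)"

primrec eval :: "('f, 'a) algebra \<Rightarrow> ('v \<Rightarrow> 'a) \<Rightarrow> ('f, 'v) fm \<Rightarrow> 'a" where
  "eval A h (Var x) = h x"
| "eval A h (Op f ts) = interp A f (map (eval A h) ts)"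

section \<open>Equational consequence and algebraizability\<close>

text \<open>The equation \<open>s \<approx> t\<close> is the pair \<open>(s, t)\<close>. The set of variables is \<^typ>\<open>nat\<close>.\<close>

type_synonym 'f equation = "('f, nat) fm \<times> ('f, nat) fm"

definition eq_holds :: "('f, 'a) algebra \<Rightarrow> (nat \<Rightarrow> 'a) \<Rightarrow> 'f equation \<Rightarrow> bool" where
  "eq_holds A h e \<longleftrightarrow> eval A h (fst e) = eval A h (snd e)"

definition eq_conseq :: "('f, 'a) algebra set \<Rightarrow> 'f equation set \<Rightarrow> 'f equation \<Rightarrow> bool" where
  "eq_conseq K \<Theta> e \<longleftrightarrow>
     (\<forall>A\<in>K. \<forall>h. range h \<subseteq> univ A \<longrightarrow> (\<forall>d\<in>\<Theta>. eq_holds A h d) \<longrightarrow> eq_holds A h e)"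

definition eq_conseq_set :: "('f, 'a) algebra set \<Rightarrow> 'f equation set \<Rightarrow> 'f equation set \<Rightarrow> bool" where
  "eq_conseq_set K \<Theta> \<Theta>' \<longleftrightarrow> (\<forall>e\<in>\<Theta>'. eq_conseq K \<Theta> e)"

definition eq_finitary :: "'f signature \<Rightarrow> ('f, 'a) algebra set \<Rightarrow> bool" where
  "eq_finitary \<Sigma> K \<longleftrightarrow>
     (\<forall>\<Theta> e. \<Theta> \<subseteq> formulas \<Sigma> \<times> formulas \<Sigma> \<longrightarrow> e \<in> formulas \<Sigma> \<times> formulas \<Sigma> \<longrightarrow> eq_conseq K \<Theta> e \<longrightarrow>
       (\<exists>\<Theta>\<^sub>0. finite \<Theta>\<^sub>0 \<and> \<Theta>\<^sub>0 \<subseteq> \<Theta> \<and> eq_conseq K \<Theta>\<^sub>0 e))"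

text \<open>\<open>inst E \<phi>\<close> is \<open>E(\<phi>)\<close>: in a set \<open>E(x)\<close> of equations in one variable, \<open>x\<close> is variable \<open>0\<close>.\<close>

definition inst :: "'f equation set \<Rightarrow> ('f, nat) fm \<Rightarrow> 'f equation set" where
  "inst E \<phi> = (\<lambda>(s, t). (subst (Var(0 := \<phi>)) s, subst (Var(0 := \<phi>)) t)) ` E"

text \<open>In \<open>\<Delta>(x, y)\<close> the variables \<open>x\<close> and \<open>y\<close> are \<open>0\<close> and \<open>1\<close>, so that each \<open>\<delta> \<in> \<Delta>\<close> is already
  \<open>\<delta>(x, y)\<close>.\<close>

definition algebraizable_via ::
  "'f signature \<Rightarrow> (('f, nat) fm set \<Rightarrow> ('f, nat) fm \<Rightarrow> bool) \<Rightarrow>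
   ('f, 'a) algebra set \<Rightarrow> 'f equation set \<Rightarrow> ('f, nat) fm set \<Rightarrow> bool" where
  "algebraizable_via \<Sigma> L K E \<Delta> \<longleftrightarrow>
     (\<forall>A\<in>K. is_algebra \<Sigma> A) \<and> eq_finitary \<Sigma> K \<and>
     finite E \<and> E \<subseteq> formulas \<Sigma> \<times> formulas \<Sigma> \<and> (\<forall>(s, t)\<in>E. vars s \<subseteq> {0} \<and> vars t \<subseteq> {0}) \<and>
     finite \<Delta> \<and> \<Delta> \<subseteq> formulas \<Sigma> \<and> (\<forall>\<delta>\<in>\<Delta>. vars \<delta> \<subseteq> {0, 1}) \<and>
     (\<forall>\<Gamma> \<phi>. \<Gamma> \<subseteq> formulas \<Sigma> \<longrightarrow> \<phi> \<in> formulas \<Sigma> \<longrightarrow>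
        (L \<Gamma> \<phi> \<longleftrightarrow> eq_conseq_set K (\<Union>\<gamma>\<in>\<Gamma>. inst E \<gamma>) (inst E \<phi>))) \<and>
     eq_conseq_set K {(Var 0, Var 1)} (\<Union>\<delta>\<in>\<Delta>. inst E \<delta>) \<and>
     eq_conseq_set K (\<Union>\<delta>\<in>\<Delta>. inst E \<delta>) {(Var 0, Var 1)}"

text \<open>The class \<open>K\<close> is a set of algebras whose universes are subsets of the type \<open>'a\<close>. Allowing only
  sets is no restriction when \<open>'a\<close> ranges over all types: one algebra refuting each
  non-consequence suffices to determine \<open>\<Turnstile>\<^sub>K\<close>.\<close>

definition algebraizable ::
  "'a itself \<Rightarrow> 'f signature \<Rightarrow> (('f, nat) fm set \<Rightarrow> ('f, nat) fm \<Rightarrow> bool) \<Rightarrow> bool" where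
  "algebraizable T \<Sigma> L \<longleftrightarrow> (\<exists>(K :: ('f, 'a) algebra set) E \<Delta>. algebraizable_via \<Sigma> L K E \<Delta>)"

section \<open>The logics\<close>

datatype con = Disj | Conj | Impl | Incomp | Neg

type_synonym form = "(con, nat) fm"

abbreviation fm_disj :: "form \<Rightarrow> form \<Rightarrow> form"  (infixr \<open>\<^bold>\<or>\<close> 130) where
  "\<alpha> \<^bold>\<or> \<beta> \<equiv> Op Disj [\<alpha>, \<beta>]"

abbreviation fm_conj :: "form \<Rightarrow> form \<Rightarrow> form"  (infixr \<open>\<^bold>\<and>\<close> 135) where
  "\<alpha> \<^bold>\<and> \<beta> \<equiv> Op Conj [\<alpha>, \<beta>]"

abbreviation fm_impl :: "form \<Rightarrow> form \<Rightarrow> form"  (infixr \<open>\<^bold>\<rightarrow>\<close> 125) where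
  "\<alpha> \<^bold>\<rightarrow> \<beta> \<equiv> Op Impl [\<alpha>, \<beta>]"

abbreviation fm_incomp :: "form \<Rightarrow> form \<Rightarrow> form"  (infix \<open>\<^bold>\<up>\<close> 140) where
  "\<alpha> \<^bold>\<up> \<beta> \<equiv> Op Incomp [\<alpha>, \<beta>]"

abbreviation fm_neg :: "form \<Rightarrow> form"  (\<open>\<^bold>\<not> _\<close> [145] 145) where
  "\<^bold>\<not> \<alpha> \<equiv> Op Neg [\<alpha>]"

definition sig_bI :: "con signature" where
  "sig_bI = [Disj \<mapsto> 2, Conj \<mapsto> 2, Impl \<mapsto> 2, Incomp \<mapsto> 2]"

definition sig_nbI :: "con signature" where
  "sig_nbI = sig_bI(Neg \<mapsto> 1)"

inductive_set ax_bI :: "con signature \<Rightarrow> form set" for \<Sigma> :: "con signature" where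
  Ax1: "\<lbrakk>\<alpha> \<in> formulas \<Sigma>; \<beta> \<in> formulas \<Sigma>\<rbrakk> \<Longrightarrow> \<alpha> \<^bold>\<rightarrow> (\<beta> \<^bold>\<rightarrow> \<alpha>) \<in> ax_bI \<Sigma>"
| Ax2: "\<lbrakk>\<alpha> \<in> formulas \<Sigma>; \<beta> \<in> formulas \<Sigma>; \<gamma> \<in> formulas \<Sigma>\<rbrakk> \<Longrightarrow>
    (\<alpha> \<^bold>\<rightarrow> (\<beta> \<^bold>\<rightarrow> \<gamma>)) \<^bold>\<rightarrow> ((\<alpha> \<^bold>\<rightarrow> \<beta>) \<^bold>\<rightarrow> (\<alpha> \<^bold>\<rightarrow> \<gamma>)) \<in> ax_bI \<Sigma>"
| Ax3: "\<lbrakk>\<alpha> \<in> formulas \<Sigma>; \<beta> \<in> formulas \<Sigma>\<rbrakk> \<Longrightarrow> \<alpha> \<^bold>\<rightarrow> (\<beta> \<^bold>\<rightarrow> (\<alpha> \<^bold>\<and> \<beta>)) \<in> ax_bI \<Sigma>"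
| Ax4: "\<lbrakk>\<alpha> \<in> formulas \<Sigma>; \<beta> \<in> formulas \<Sigma>\<rbrakk> \<Longrightarrow> (\<alpha> \<^bold>\<and> \<beta>) \<^bold>\<rightarrow> \<alpha> \<in> ax_bI \<Sigma>"
| Ax5: "\<lbrakk>\<alpha> \<in> formulas \<Sigma>; \<beta> \<in> formulas \<Sigma>\<rbrakk> \<Longrightarrow> (\<alpha> \<^bold>\<and> \<beta>) \<^bold>\<rightarrow> \<beta> \<in> ax_bI \<Sigma>"
| Ax6: "\<lbrakk>\<alpha> \<in> formulas \<Sigma>; \<beta> \<in> formulas \<Sigma>\<rbrakk> \<Longrightarrow> \<alpha> \<^bold>\<rightarrow> (\<alpha> \<^bold>\<or> \<beta>) \<in> ax_bI \<Sigma>"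
| Ax7: "\<lbrakk>\<alpha> \<in> formulas \<Sigma>; \<beta> \<in> formulas \<Sigma>\<rbrakk> \<Longrightarrow> \<beta> \<^bold>\<rightarrow> (\<alpha> \<^bold>\<or> \<beta>) \<in> ax_bI \<Sigma>"
| Ax8: "\<lbrakk>\<alpha> \<in> formulas \<Sigma>; \<beta> \<in> formulas \<Sigma>; \<gamma> \<in> formulas \<Sigma>\<rbrakk> \<Longrightarrow>
    (\<alpha> \<^bold>\<rightarrow> \<gamma>) \<^bold>\<rightarrow> ((\<beta> \<^bold>\<rightarrow> \<gamma>) \<^bold>\<rightarrow> ((\<alpha> \<^bold>\<or> \<beta>) \<^bold>\<rightarrow> \<gamma>)) \<in> ax_bI \<Sigma>"
| Ax9: "\<lbrakk>\<alpha> \<in> formulas \<Sigma>; \<beta> \<in> formulas \<Sigma>\<rbrakk> \<Longrightarrow> (\<alpha> \<^bold>\<rightarrow> \<beta>) \<^bold>\<or> \<alpha> \<in> ax_bI \<Sigma>"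
| Ip: "\<lbrakk>\<alpha> \<in> formulas \<Sigma>; \<beta> \<in> formulas \<Sigma>; \<gamma> \<in> formulas \<Sigma>\<rbrakk> \<Longrightarrow>
    (\<alpha> \<^bold>\<up> \<beta>) \<^bold>\<rightarrow> (\<alpha> \<^bold>\<rightarrow> (\<beta> \<^bold>\<rightarrow> \<gamma>)) \<in> ax_bI \<Sigma>"
| Comm: "\<lbrakk>\<alpha> \<in> formulas \<Sigma>; \<beta> \<in> formulas \<Sigma>\<rbrakk> \<Longrightarrow> (\<alpha> \<^bold>\<up> \<beta>) \<^bold>\<rightarrow> (\<beta> \<^bold>\<up> \<alpha>) \<in> ax_bI \<Sigma>"

definition ax_nbI :: "form set" where
  "ax_nbI = ax_bI sig_nbI \<union> {\<alpha> \<^bold>\<or> \<^bold>\<not> \<alpha> | \<alpha>. \<alpha> \<in> formulas sig_nbI}"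

definition ax_nbIciw :: "form set" where
  "ax_nbIciw = ax_nbI \<union> {(\<alpha> \<^bold>\<up> \<^bold>\<not> \<alpha>) \<^bold>\<or> (\<alpha> \<^bold>\<and> \<^bold>\<not> \<alpha>) | \<alpha>. \<alpha> \<in> formulas sig_nbI}"

definition ax_nbIci :: "form set" where
  "ax_nbIci = ax_nbI \<union> {\<^bold>\<not> (\<alpha> \<^bold>\<up> \<^bold>\<not> \<alpha>) \<^bold>\<rightarrow> (\<alpha> \<^bold>\<and> \<^bold>\<not> \<alpha>) | \<alpha>. \<alpha> \<in> formulas sig_nbI}"

definition ax_nbIcl :: "form set" where
  "ax_nbIcl = ax_nbI \<union> {\<^bold>\<not> (\<alpha> \<^bold>\<and> \<^bold>\<not> \<alpha>) \<^bold>\<rightarrow> (\<alpha> \<^bold>\<up> \<^bold>\<not> \<alpha>) | \<alpha>. \<alpha> \<in> formulas sig_nbI}"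

inductive derivable :: "form set \<Rightarrow> form set \<Rightarrow> form \<Rightarrow> bool" for Ax \<Gamma> :: "form set" where
  axiom: "\<phi> \<in> Ax \<Longrightarrow> derivable Ax \<Gamma> \<phi>"
| premise: "\<phi> \<in> \<Gamma> \<Longrightarrow> derivable Ax \<Gamma> \<phi>"
| MP: "\<lbrakk>derivable Ax \<Gamma> \<alpha>; derivable Ax \<Gamma> (\<alpha> \<^bold>\<rightarrow> \<beta>)\<rbrakk> \<Longrightarrow> derivable Ax \<Gamma> \<beta>"

definition bI :: "form set \<Rightarrow> form \<Rightarrow> bool" where "bI = derivable (ax_bI sig_bI)"
definition nbI :: "form set \<Rightarrow> form \<Rightarrow> bool" where "nbI = derivable ax_nbI"
definition nbIciw :: "form set \<Rightarrow> form \<Rightarrow> bool" where "nbIciw = derivable ax_nbIciw"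
definition nbIci :: "form set \<Rightarrow> form \<Rightarrow> bool" where "nbIci = derivable ax_nbIci"
definition nbIcl :: "form set \<Rightarrow> form \<Rightarrow> bool" where "nbIcl = derivable ax_nbIcl"

end

theory Submission
  imports Defs
begin

text \<open>Suppose a logic is algebraizable through \<open>K\<close>, \<open>E\<close> and \<open>\<Delta>\<close>, and let \<open>F\<close> be a filter of the
  logic on an algebra \<open>M\<close> (so that \<open>(M, F)\<close> is a matrix model). Say that \<open>u\<close> and \<open>v\<close> are identified
  by \<open>F\<close> if \<open>\<delta>(u, v) \<in> F\<close> for all \<open>\<delta> \<in> \<Delta>\<close>; this is the Leibniz congruence of \<open>F\<close>. It determines
  \<open>F\<close>, because \<open>u \<in> F\<close> holds iff the two sides of every equation of \<open>E(u)\<close> are identified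
  (\<open>filter_mem_iff\<close>). Hence two different filters on one algebra cannot both have the identity as
  their Leibniz congruence. On the other hand, identified elements can be replaced by each other
  inside a formula without leaving \<open>F\<close> (\<open>replacement\<close>), so the congruence is the identity as soon as
  formulas with parameters separate the points of \<open>M\<close> with respect to \<open>F\<close>
  (\<open>separated_filters_eq\<close>).

  One algebra refutes all five logics: a Boolean algebra with its usual operations and with
  \<open>x \<up> y = 1\<close> if \<open>y\<close> is the complement of \<open>x\<close>, and \<open>x \<up> y = 0\<close> otherwise. All axioms take the value
  \<open>1\<close> in it, so every lattice filter is a filter of the logics. The formula \<open>x \<up> q\<close> with
  \<open>q\<close> interpreted as the complement of \<open>u\<close> takes the value \<open>1\<close> at \<open>u\<close> and \<open>0\<close> everywhere else, so
  it separates points for every proper filter. The four-element Boolean algebra already has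
  several proper filters.\<close>

section \<open>Substitution and matrix models\<close>

lemma eval_subst: "eval A h (subst \<sigma> t) = eval A (\<lambda>x. eval A h (\<sigma> x)) t"
  by (induction t) (auto cong: map_cong)

lemma eval_cong: "(\<And>x. x \<in> vars t \<Longrightarrow> h x = h' x) \<Longrightarrow> eval A h t = eval A h' t"
proof (induction t)
  case (Op f ts)
  then have "map (eval A h) ts = map (eval A h') ts"
    by (auto intro!: map_cong)
  then show ?case by (simp only: eval.simps)
qed simp

lemma eval_in_univ:
  assumes "t \<in> formulas \<Sigma>" "is_algebra \<Sigma> A" "range h \<subseteq> univ A"
  shows "eval A h t \<in> univ A"
  using assms
proof (induction t rule: formulas.induct)
  case (Op f ts)
  then have "set (map (eval A h) ts) \<subseteq> univ A" by auto
  with Op show ?case unfolding is_algebra_def by (metis eval.simps(2) length_map)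
qed auto

lemma subst_formulas:
  "t \<in> formulas \<Sigma> \<Longrightarrow> (\<And>x. \<sigma> x \<in> formulas \<Sigma>) \<Longrightarrow> subst \<sigma> t \<in> formulas \<Sigma>"
  by (induction t rule: formulas.induct) (auto intro!: formulas.Op)

definition pair_subst :: "('f, nat) fm \<Rightarrow> ('f, nat) fm \<Rightarrow> ('f, nat) fm \<Rightarrow> ('f, nat) fm" where
  "pair_subst s t = subst (Var(0 := s, 1 := t))"

lemma pair_subst_formulas:
  "\<lbrakk>\<delta> \<in> formulas \<Sigma>; s \<in> formulas \<Sigma>; t \<in> formulas \<Sigma>\<rbrakk> \<Longrightarrow> pair_subst s t \<delta> \<in> formulas \<Sigma>"
  unfolding pair_subst_def by (rule subst_formulas) (auto intro: formulas.Var)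

lemma eval_pair_subst:
  "eval A h (pair_subst s t \<delta>) = eval A (h(0 := eval A h s, 1 := eval A h t)) \<delta>"
  unfolding pair_subst_def eval_subst by (rule eval_cong) auto

lemma eval_rename: "eval A h (subst (Var(x := Var y)) t) = eval A (h(x := h y)) t"
  unfolding eval_subst by (rule eval_cong) auto

definition matrix_model ::
  "'f signature \<Rightarrow> (('f, nat) fm set \<Rightarrow> ('f, nat) fm \<Rightarrow> bool) \<Rightarrow> ('f, 'b) algebra \<Rightarrow> 'b set \<Rightarrow> bool"
  where "matrix_model \<Sigma> L M F \<longleftrightarrow> is_algebra \<Sigma> M \<and> F \<subseteq> univ M \<and>
    (\<forall>\<Gamma> \<phi> h. \<Gamma> \<subseteq> formulas \<Sigma> \<longrightarrow> \<phi> \<in> formulas \<Sigma> \<longrightarrow> L \<Gamma> \<phi> \<longrightarrow> range h \<subseteq> univ M \<longrightarrow>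
      (\<forall>\<gamma>\<in>\<Gamma>. eval M h \<gamma> \<in> F) \<longrightarrow> eval M h \<phi> \<in> F)"

lemma matrix_modelD:
  assumes "matrix_model \<Sigma> L M F" "L \<Gamma> \<phi>" "\<Gamma> \<subseteq> formulas \<Sigma>" "\<phi> \<in> formulas \<Sigma>" "range h \<subseteq> univ M"
    "\<And>\<gamma>. \<gamma> \<in> \<Gamma> \<Longrightarrow> eval M h \<gamma> \<in> F"
  shows "eval M h \<phi> \<in> F"
  using assms unfolding matrix_model_def by blast

section \<open>The Leibniz congruence of a filter\<close>

lemma eq_conseqD:
  "\<lbrakk>eq_conseq K \<Theta> e; A \<in> K; range h \<subseteq> univ A; \<And>d. d \<in> \<Theta> \<Longrightarrow> eq_holds A h d\<rbrakk> \<Longrightarrow> eq_holds A h e"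
  unfolding eq_conseq_def by blast

locale algebraization =
  fixes \<Sigma> :: "'f signature" and L :: "('f, nat) fm set \<Rightarrow> ('f, nat) fm \<Rightarrow> bool"
    and K :: "('f, 'a) algebra set" and E :: "'f equation set" and \<Delta> :: "('f, nat) fm set"
  assumes via: "algebraizable_via \<Sigma> L K E \<Delta>"
begin

lemma algebra_K: "A \<in> K \<Longrightarrow> is_algebra \<Sigma> A"
  and E_formulas: "(s, t) \<in> E \<Longrightarrow> s \<in> formulas \<Sigma>" "(s, t) \<in> E \<Longrightarrow> t \<in> formulas \<Sigma>"
  and E_vars: "(s, t) \<in> E \<Longrightarrow> vars s \<subseteq> {0}" "(s, t) \<in> E \<Longrightarrow> vars t \<subseteq> {0}"
  and \<Delta>_formulas: "\<delta> \<in> \<Delta> \<Longrightarrow> \<delta> \<in> formulas \<Sigma>"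
  and \<Delta>_vars: "\<delta> \<in> \<Delta> \<Longrightarrow> vars \<delta> \<subseteq> {0, 1}"
  using via unfolding algebraizable_via_def by auto

text \<open>The equations of \<open>E\<close> contain only one variable, so a constant valuation suffices to evaluate
  \<open>E(\<phi>)\<close>.\<close>

definition true_at :: "('f, 'a) algebra \<Rightarrow> (nat \<Rightarrow> 'a) \<Rightarrow> ('f, nat) fm \<Rightarrow> bool" where
  "true_at A h \<phi> \<longleftrightarrow> (\<forall>(s, t)\<in>E. eval A (\<lambda>_. eval A h \<phi>) s = eval A (\<lambda>_. eval A h \<phi>) t)"

lemma eval_E_iff:
  assumes "(s, t) \<in> E"
  shows "eval A (\<lambda>_. h 0) s = eval A (\<lambda>_. h 0) t \<longleftrightarrow> eval A h s = eval A h t"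
proof -
  have "eval A (\<lambda>_. h 0) r = eval A h r" if "vars r \<subseteq> {0}" for r
    using that by (intro eval_cong) auto
  then show ?thesis using E_vars[OF assms] by simp
qed

lemma true_at_iff: "true_at A h \<phi> \<longleftrightarrow> (\<forall>e\<in>inst E \<phi>. eq_holds A h e)"
proof -
  have "eval A (\<lambda>_. eval A h \<phi>) r = eval A h (subst (Var(0 := \<phi>)) r)" if "vars r \<subseteq> {0}" for r
    unfolding eval_subst using that by (intro eval_cong) auto
  then show ?thesis
    using E_vars unfolding true_at_def inst_def eq_holds_def by fastforce
qed

lemma consequence_iff:
  assumes "\<Gamma> \<subseteq> formulas \<Sigma>" "\<phi> \<in> formulas \<Sigma>"
  shows "L \<Gamma> \<phi> \<longleftrightarrow>
    (\<forall>A\<in>K. \<forall>h. range h \<subseteq> univ A \<longrightarrow> (\<forall>\<gamma>\<in>\<Gamma>. true_at A h \<gamma>) \<longrightarrow> true_at A h \<phi>)"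
proof -
  have "L \<Gamma> \<phi> \<longleftrightarrow> eq_conseq_set K (\<Union>\<gamma>\<in>\<Gamma>. inst E \<gamma>) (inst E \<phi>)"
    using via assms unfolding algebraizable_via_def by blast
  also have "\<dots> \<longleftrightarrow>
    (\<forall>A\<in>K. \<forall>h. range h \<subseteq> univ A \<longrightarrow> (\<forall>\<gamma>\<in>\<Gamma>. true_at A h \<gamma>) \<longrightarrow> true_at A h \<phi>)"
    unfolding eq_conseq_set_def eq_conseq_def true_at_iff by blast
  finally show ?thesis .
qed

text \<open>Condition (ii) of algebraizability, transported from the variables \<open>x\<close> and \<open>y\<close> to arbitrary
  formulas.\<close>

lemma true_at_\<Delta>_iff:
  assumes A: "A \<in> K" and h: "range h \<subseteq> univ A" and st: "s \<in> formulas \<Sigma>" "t \<in> formulas \<Sigma>"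
  shows "(\<forall>\<delta>\<in>\<Delta>. true_at A h (pair_subst s t \<delta>)) \<longleftrightarrow> eval A h s = eval A h t"
proof -
  let ?h = "h(0 := eval A h s, 1 := eval A h t)"
  have h': "range ?h \<subseteq> univ A"
    using h eval_in_univ[OF _ algebra_K[OF A] h] st by (auto simp: image_subset_iff)
  have "eq_conseq_set K {(Var 0, Var 1)} (\<Union>\<delta>\<in>\<Delta>. inst E \<delta>)"
    and "eq_conseq_set K (\<Union>\<delta>\<in>\<Delta>. inst E \<delta>) {(Var 0, Var 1)}"
    using via unfolding algebraizable_via_def by blast+
  then have conseq: "\<And>\<delta> e. \<delta> \<in> \<Delta> \<Longrightarrow> e \<in> inst E \<delta> \<Longrightarrow> eq_conseq K {(Var 0, Var 1)} e"
    and conseq': "eq_conseq K (\<Union>\<delta>\<in>\<Delta>. inst E \<delta>) (Var 0, Var 1)"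
    unfolding eq_conseq_set_def by blast+
  have "(\<forall>\<delta>\<in>\<Delta>. \<forall>e\<in>inst E \<delta>. eq_holds A ?h e) \<longleftrightarrow> eq_holds A ?h (Var 0, Var 1)"
    (is "?lhs \<longleftrightarrow> ?rhs")
  proof
    assume ?lhs
    then show ?rhs by - (rule eq_conseqD[OF conseq' A h'], blast)
  next
    assume ?rhs
    show ?lhs
    proof (intro ballI)
      fix \<delta> e assume "\<delta> \<in> \<Delta>" "e \<in> inst E \<delta>"
      from eq_conseqD[OF conseq[OF this] A h'] \<open>?rhs\<close> show "eq_holds A ?h e" by blast
    qed
  qed
  then have "(\<forall>\<delta>\<in>\<Delta>. true_at A ?h \<delta>) \<longleftrightarrow> eq_holds A ?h (Var 0, Var 1)"
    by (simp only: true_at_iff)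
  then show ?thesis
    unfolding true_at_def eval_pair_subst by (simp add: eq_holds_def)
qed

text \<open>This is the Leibniz congruence of \<open>F\<close>. The formulas of \<open>\<Delta>\<close> contain at most the variables \<open>0\<close>
  and \<open>1\<close>, so the values of the other variables are arbitrary.\<close>

definition identified :: "('f, 'b) algebra \<Rightarrow> 'b set \<Rightarrow> 'b \<Rightarrow> 'b \<Rightarrow> bool" where
  "identified M F u v \<longleftrightarrow> (\<forall>\<delta>\<in>\<Delta>. eval M ((\<lambda>_. u)(1 := v)) \<delta> \<in> F)"

lemma identified_eval_iff:
  "identified M F (eval M h s) (eval M h t) \<longleftrightarrow> (\<forall>\<delta>\<in>\<Delta>. eval M h (pair_subst s t \<delta>) \<in> F)"
proof -
  have "eval M ((\<lambda>_. eval M h s)(1 := eval M h t)) \<delta> = eval M h (pair_subst s t \<delta>)"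
    if "\<delta> \<in> \<Delta>" for \<delta>
    unfolding eval_pair_subst using \<Delta>_vars[OF that] by (intro eval_cong) auto
  then show ?thesis unfolding identified_def by simp
qed

lemma identified_refl:
  assumes M: "matrix_model \<Sigma> L M F" and u: "u \<in> univ M"
  shows "identified M F u u"
proof -
  have "eval M (\<lambda>_. u) (pair_subst (Var 0) (Var 0) \<delta>) \<in> F" if "\<delta> \<in> \<Delta>" for \<delta>
  proof (rule matrix_modelD[OF M, of "{}"])
    show fm: "pair_subst (Var 0) (Var 0) \<delta> \<in> formulas \<Sigma>"
      by (intro pair_subst_formulas \<Delta>_formulas that formulas.Var)
    show "L {} (pair_subst (Var 0) (Var 0) \<delta>)"
      using true_at_\<Delta>_iff[OF _ _ formulas.Var formulas.Var, of _ _ 0 0] that fm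
      by (subst consequence_iff) blast+
  qed (use u in auto)
  then show ?thesis
    using identified_eval_iff[of M F "\<lambda>_. u" "Var 0" "Var 0"] by simp
qed

text \<open>In \<open>K\<close>, the premises \<open>\<Delta>(x, y)\<close> force \<open>x\<close> and \<open>y\<close> to be equal, so that \<open>\<phi>(x)\<close> and
  \<open>\<phi>(y)\<close> have the same value; \<open>\<phi>(x)\<close> and \<open>\<Delta>(x, y)\<close> therefore derive \<open>\<phi>(y)\<close>. The valuation \<open>h\<close>
  supplies the parameters of \<open>\<phi>\<close>, and the variable \<open>1\<close> is kept free to stand for \<open>y\<close>.\<close>

lemma replacement:
  fixes \<phi> :: "('f, nat) fm"
  assumes M: "matrix_model \<Sigma> L M F" and h: "range h \<subseteq> univ M"
    and u: "u \<in> univ M" and v: "v \<in> univ M" and uv: "identified M F u v"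
    and \<phi>: "\<phi> \<in> formulas \<Sigma>" "1 \<notin> vars \<phi>"
    and F: "eval M (h(0 := u)) \<phi> \<in> F"
  shows "eval M (h(0 := v)) \<phi> \<in> F"
proof -
  let ?\<Gamma> = "insert \<phi> (pair_subst (Var 0) (Var 1) ` \<Delta>)"
  let ?\<psi> = "subst (Var(0 := Var 1)) \<phi>"
  let ?h = "h(0 := u, 1 := v)"
  have "pair_subst (Var 0) (Var 1) \<delta> \<in> formulas \<Sigma>" if "\<delta> \<in> \<Delta>" for \<delta>
    by (intro pair_subst_formulas \<Delta>_formulas that formulas.Var)
  moreover have "?\<psi> \<in> formulas \<Sigma>"
    by (rule subst_formulas[OF \<phi>(1)]) (simp add: formulas.Var)
  ultimately have fm: "?\<Gamma> \<subseteq> formulas \<Sigma>" "?\<psi> \<in> formulas \<Sigma>"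
    using \<phi>(1) by blast+
  have "true_at A g ?\<psi>"
    if A: "A \<in> K" "range g \<subseteq> univ A" and \<Gamma>: "\<forall>\<gamma>\<in>?\<Gamma>. true_at A g \<gamma>" for A g
  proof -
    have "g 0 = g 1"
      using true_at_\<Delta>_iff[OF A formulas.Var formulas.Var, of 0 1] \<Gamma> by simp
    then have "g(0 := g 1) = g" by (metis fun_upd_triv)
    then have "eval A g ?\<psi> = eval A g \<phi>" by (simp only: eval_rename)
    then show ?thesis using \<Gamma> unfolding true_at_def by auto
  qed
  then have L: "L ?\<Gamma> ?\<psi>" unfolding consequence_iff[OF fm] by blast
  have range: "range ?h \<subseteq> univ M" using h u v by (auto simp: image_subset_iff)
  have "eval M ?h \<gamma> \<in> F" if "\<gamma> \<in> ?\<Gamma>" for \<gamma>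
  proof -
    have "eval M ?h \<phi> = eval M (h(0 := u)) \<phi>"
      using \<phi>(2) by (intro eval_cong) auto
    moreover have "\<forall>\<delta>\<in>\<Delta>. eval M ?h (pair_subst (Var 0) (Var 1) \<delta>) \<in> F"
      using uv identified_eval_iff[of M F ?h "Var 0" "Var 1"] by simp
    ultimately show ?thesis using that F by auto
  qed
  then have "eval M ?h ?\<psi> \<in> F" by (rule matrix_modelD[OF M L fm range])
  moreover have "eval M ?h ?\<psi> = eval M (h(0 := v)) \<phi>"
    unfolding eval_rename using \<phi>(2) by (intro eval_cong) auto
  ultimately show ?thesis by simp
qed

text \<open>The formula \<open>x\<close> is interderivable with \<open>\<Delta>(E(x))\<close>: in \<open>K\<close>, both say that \<open>x\<close> solves \<open>E\<close>. This is
  where both halves of the definition of algebraizability meet.\<close>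

lemma filter_mem_iff:
  assumes M: "matrix_model \<Sigma> L M F" and u: "u \<in> univ M"
  shows "u \<in> F \<longleftrightarrow> (\<forall>(s, t)\<in>E. identified M F (eval M (\<lambda>_. u) s) (eval M (\<lambda>_. u) t))"
proof -
  let ?\<Gamma> = "\<Union>(s, t)\<in>E. pair_subst s t ` \<Delta>"
  have fm: "{Var 0 :: ('f, nat) fm} \<subseteq> formulas \<Sigma>" "(Var 0 :: ('f, nat) fm) \<in> formulas \<Sigma>"
    by (auto intro: formulas.Var)
  have fm\<Gamma>: "?\<Gamma> \<subseteq> formulas \<Sigma>"
    using pair_subst_formulas[OF \<Delta>_formulas E_formulas] by blast
  have key: "true_at A h (Var 0) \<longleftrightarrow> (\<forall>\<gamma>\<in>?\<Gamma>. true_at A h \<gamma>)" if "A \<in> K" "range h \<subseteq> univ A" for A h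
  proof -
    have "true_at A h (Var 0) \<longleftrightarrow> (\<forall>(s, t)\<in>E. eval A h s = eval A h t)"
      unfolding true_at_def eval.simps using eval_E_iff[of _ _ A h] by blast
    also have "\<dots> \<longleftrightarrow> (\<forall>(s, t)\<in>E. \<forall>\<delta>\<in>\<Delta>. true_at A h (pair_subst s t \<delta>))"
      using true_at_\<Delta>_iff[OF that] E_formulas by fast
    finally show ?thesis by auto
  qed
  have range: "range (\<lambda>_. u) \<subseteq> univ M" using u by auto
  have "u \<in> F \<longleftrightarrow> (\<forall>\<gamma>\<in>?\<Gamma>. eval M (\<lambda>_. u) \<gamma> \<in> F)"
  proof
    assume "u \<in> F"
    show "\<forall>\<gamma>\<in>?\<Gamma>. eval M (\<lambda>_. u) \<gamma> \<in> F"
    proof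
      fix \<gamma> assume \<gamma>: "\<gamma> \<in> ?\<Gamma>"
      with fm\<Gamma> have \<gamma>_fm: "\<gamma> \<in> formulas \<Sigma>" by blast
      have "L {Var 0} \<gamma>"
        unfolding consequence_iff[OF fm(1) \<gamma>_fm] using key \<gamma> by blast
      then show "eval M (\<lambda>_. u) \<gamma> \<in> F"
        by (rule matrix_modelD[OF M _ fm(1) \<gamma>_fm range]) (use \<open>u \<in> F\<close> in simp)
    qed
  next
    assume *: "\<forall>\<gamma>\<in>?\<Gamma>. eval M (\<lambda>_. u) \<gamma> \<in> F"
    have "L ?\<Gamma> (Var 0)"
      unfolding consequence_iff[OF fm\<Gamma> fm(2)] using key by blast
    from matrix_modelD[OF M this fm\<Gamma> fm(2) range] *
    have "eval M (\<lambda>_. u) (Var 0 :: ('f, nat) fm) \<in> F"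
      by blast
    then show "u \<in> F" by simp
  qed
  then show ?thesis unfolding identified_eval_iff by auto
qed

text \<open>Separation of points makes the Leibniz congruences of both filters the identity, and a filter
  is determined by its Leibniz congruence.\<close>

theorem separated_filters_eq:
  fixes \<phi> :: "('f, nat) fm"
  assumes M: "matrix_model \<Sigma> L M F" "matrix_model \<Sigma> L M G"
    and \<phi>: "\<phi> \<in> formulas \<Sigma>" "1 \<notin> vars \<phi>"
    and sep: "\<And>u v. \<lbrakk>u \<in> univ M; v \<in> univ M; u \<noteq> v\<rbrakk> \<Longrightarrow> \<exists>h. range h \<subseteq> univ M \<and>
      eval M (h(0 := u)) \<phi> \<in> F \<inter> G \<and> eval M (h(0 := v)) \<phi> \<notin> F \<union> G"
  shows "F = G"
proof -
  have identified_iff: "identified M H u v \<longleftrightarrow> u = v"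
    if H: "H = F \<or> H = G" and uv: "u \<in> univ M" "v \<in> univ M" for H u v
  proof -
    have model: "matrix_model \<Sigma> L M H" using H M by blast
    have False if id: "identified M H u v" and neq: "u \<noteq> v"
    proof -
      obtain h where h: "range h \<subseteq> univ M"
        "eval M (h(0 := u)) \<phi> \<in> F \<inter> G" "eval M (h(0 := v)) \<phi> \<notin> F \<union> G"
        using sep[OF uv neq] by blast
      then show False
        using replacement[OF model h(1) uv id \<phi>] H by blast
    qed
    then show ?thesis using identified_refl[OF model uv(1)] by blast
  qed
  have alg: "is_algebra \<Sigma> M" and sub: "F \<subseteq> univ M" "G \<subseteq> univ M"
    using M unfolding matrix_model_def by blast+
  have "u \<in> F \<longleftrightarrow> u \<in> G" if u: "u \<in> univ M" for u
  proof -
    have "eval M (\<lambda>_. u) r \<in> univ M" if "r \<in> formulas \<Sigma>" for r :: "('f, nat) fm"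
      using eval_in_univ[OF that alg] u by auto
    then have "identified M F (eval M (\<lambda>_. u) s) (eval M (\<lambda>_. u) t) \<longleftrightarrow>
        identified M G (eval M (\<lambda>_. u) s) (eval M (\<lambda>_. u) t)" if "(s, t) \<in> E" for s t
      using identified_iff E_formulas[OF that] by simp
    then show ?thesis
      unfolding filter_mem_iff[OF M(1) u] filter_mem_iff[OF M(2) u] by blast
  qed
  then show ?thesis using sub by blast
qed

end

section \<open>Incompatibility as complementation in a Boolean algebra\<close>

text \<open>The schema (Ip) only requires \<open>x \<up> y\<close> to be disjoint from \<open>x \<inter> y\<close>. The value \<open>UNIV\<close> at
  complements, whose intersection is empty, validates the schemata about \<open>\<alpha> \<up> \<not>\<alpha>\<close>; the value
  \<open>{}\<close> elsewhere makes \<open>\<up>\<close> sensitive to every difference between two sets.\<close>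

fun set_interp :: "con \<Rightarrow> 'b set list \<Rightarrow> 'b set" where
  "set_interp Disj [X, Y] = X \<union> Y"
| "set_interp Conj [X, Y] = X \<inter> Y"
| "set_interp Impl [X, Y] = - X \<union> Y"
| "set_interp Incomp [X, Y] = (if Y = - X then UNIV else {})"
| "set_interp Neg [X] = - X"
| "set_interp _ _ = {}"

definition set_algebra :: "(con, 'b set) algebra" where
  "set_algebra = \<lparr>univ = UNIV, interp = set_interp\<rparr>"

lemma interp_set_algebra [simp]: "interp set_algebra = set_interp"
  and univ_set_algebra [simp]: "univ set_algebra = UNIV"
  by (simp_all add: set_algebra_def)

lemma eval_ax_bI: "\<phi> \<in> ax_bI \<Sigma> \<Longrightarrow> eval set_algebra h \<phi> = UNIV"
  by (induction rule: ax_bI.induct) auto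

lemma eval_ax_nbI: "\<phi> \<in> ax_nbI \<Longrightarrow> eval set_algebra h \<phi> = UNIV"
  unfolding ax_nbI_def by (auto simp: eval_ax_bI)

lemma eval_ax_nbIciw: "\<phi> \<in> ax_nbIciw \<Longrightarrow> eval set_algebra h \<phi> = UNIV"
  unfolding ax_nbIciw_def by (auto simp: eval_ax_nbI)

lemma eval_ax_nbIci: "\<phi> \<in> ax_nbIci \<Longrightarrow> eval set_algebra h \<phi> = UNIV"
  unfolding ax_nbIci_def by (auto simp: eval_ax_nbI)

lemma eval_ax_nbIcl: "\<phi> \<in> ax_nbIcl \<Longrightarrow> eval set_algebra h \<phi> = UNIV"
  unfolding ax_nbIcl_def by (auto simp: eval_ax_nbI)

lemma matrix_model_principal_filter:
  assumes Ax: "\<And>\<phi> h. \<phi> \<in> Ax \<Longrightarrow> eval set_algebra h \<phi> = (UNIV :: 'b set)"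
  shows "matrix_model \<Sigma> (derivable Ax) set_algebra {X :: 'b set. S \<subseteq> X}"
proof -
  have "S \<subseteq> eval set_algebra h \<phi>"
    if "derivable Ax \<Gamma> \<phi>" and "\<forall>\<gamma>\<in>\<Gamma>. S \<subseteq> eval set_algebra h \<gamma>" for \<Gamma> \<phi> h
    using that by (induction rule: derivable.induct) (auto simp: Ax)
  then show ?thesis
    unfolding matrix_model_def is_algebra_def by auto
qed

text \<open>The subsets of the two-element type form the four-element Boolean algebra; the trivial filter and
  an ultrafilter on it contradict \<open>separated_filters_eq\<close>.\<close>

lemma not_algebraizable:
  assumes Ax: "\<And>\<phi> h. \<phi> \<in> Ax \<Longrightarrow> eval set_algebra h \<phi> = (UNIV :: bool set)"
    and Incomp: "\<Sigma> Incomp = Some 2"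
  shows "\<not> algebraizable TYPE('a) \<Sigma> (derivable Ax)"
proof
  assume "algebraizable TYPE('a) \<Sigma> (derivable Ax)"
  then obtain K :: "(con, 'a) algebra set" and E \<Delta>
    where "algebraizable_via \<Sigma> (derivable Ax) K E \<Delta>"
    unfolding algebraizable_def by blast
  then interpret algebraization \<Sigma> "derivable Ax" K E \<Delta> by unfold_locales
  let ?\<phi> = "Var 0 \<^bold>\<up> Var 2"
  have "{X :: bool set. UNIV \<subseteq> X} = {X. {True} \<subseteq> X}"
  proof (rule separated_filters_eq)
    show "matrix_model \<Sigma> (derivable Ax) set_algebra {X :: bool set. UNIV \<subseteq> X}"
      and "matrix_model \<Sigma> (derivable Ax) set_algebra {X. {True} \<subseteq> X}"
      by (rule matrix_model_principal_filter; rule Ax; assumption)+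
    show "?\<phi> \<in> formulas \<Sigma>"
      using Incomp by (auto intro!: formulas.intros)
    show "1 \<notin> vars ?\<phi>" by simp
    fix u v :: "bool set"
    assume "u \<noteq> v"
    \<comment> \<open>The parameter is the complement of \<open>u\<close>, which makes \<open>x \<up> q\<close> the characteristic function
      of \<open>u\<close>.\<close>
    then show "\<exists>h. range h \<subseteq> univ set_algebra \<and>
        eval set_algebra (h(0 := u)) ?\<phi> \<in> {X. UNIV \<subseteq> X} \<inter> {X. {True} \<subseteq> X} \<and>
        eval set_algebra (h(0 := v)) ?\<phi> \<notin> {X. UNIV \<subseteq> X} \<union> {X. {True} \<subseteq> X}"
      by (intro exI[of _ "\<lambda>_. - u"]) auto
  qed
  from equalityD2[OF this] have "{True} \<in> {X :: bool set. UNIV \<subseteq> X}"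
    by (rule subsetD) simp
  then have "False \<in> {True}" by blast
  then show False by simp
qed

theorem mainTheorem14:
  shows "\<not> algebraizable TYPE('a) sig_bI bI
    \<and> \<not> algebraizable TYPE('a) sig_nbI nbI
    \<and> \<not> algebraizable TYPE('a) sig_nbI nbIciw
    \<and> \<not> algebraizable TYPE('a) sig_nbI nbIci
    \<and> \<not> algebraizable TYPE('a) sig_nbI nbIcl"
proof -
  have bI: "sig_bI Incomp = Some 2" and nbI: "sig_nbI Incomp = Some 2"
    by (simp_all add: sig_bI_def sig_nbI_def)
  have "\<not> algebraizable TYPE('a) sig_bI bI"
    unfolding bI_def by (rule not_algebraizable, erule eval_ax_bI, rule bI)
  moreover have "\<not> algebraizable TYPE('a) sig_nbI nbI"
    unfolding nbI_def by (rule not_algebraizable, erule eval_ax_nbI, rule nbI)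
  moreover have "\<not> algebraizable TYPE('a) sig_nbI nbIciw"
    unfolding nbIciw_def by (rule not_algebraizable, erule eval_ax_nbIciw, rule nbI)
  moreover have "\<not> algebraizable TYPE('a) sig_nbI nbIci"
    unfolding nbIci_def by (rule not_algebraizable, erule eval_ax_nbIci, rule nbI)
  moreover have "\<not> algebraizable TYPE('a) sig_nbI nbIcl"
    unfolding nbIcl_def by (rule not_algebraizable, erule eval_ax_nbIcl, rule nbI)
  ultimately show ?thesis by (intro conjI)
qed

end
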